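(* Suppose that $P_0$ is a Borel probability measure on $\mathbb R^d$ supported in $B_R(0)$ and satisfying the doubling condition (UD) with constant $D_{\mathrm{UD}}$. Let $M=\operatorname{supp}P_0$ and $$\Delta_0:=\sup_{y\in M}|y|^2-\inf_{y\in M}|y|^2\leq R^2.$$ Then, for every $q\geq1$, $t>0$ and $x\in\mathbb R^d$, $$\left\lVert\langle x,Y-\bar y_{x,t}\rangle\right\rVert_{L^q(\mu_{x,t})}\leq 4e^{-t/2}\left[(e^t-1)\left(\log D_{\mathrm{UD}}+\Gamma(q+1)^{1/q}\right)+\frac{\Delta_0}{2}\right],$$ where $\Gamma$ is the Gamma function. In particular, there exists a constant $C_q=C(q,D_{\mathrm{UD}})$ such that $$\mathbb E_{\mu_{x,t}}\left[|\langle x,Y-\bar y_{x,t}\rangle|^q\right]\leq C_q\left(e^{qt/2}+e^{-qt/2}R^{2q}\right)$$ for every $t>0$ and $x\in\mathbb R^d$.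
   Context: For $t>0$, $x\in\mathbb R^d$, $\mu_{x,t}$ is the posterior probability measure $$\mu_{x,t}(dy)\propto\exp\left(-\frac{|x-e^{-t/2}y|^2}{2(1-e^{-t})}\right)P_0(dy),$$ i.e. the conditional law of $X_0$ given $X_t=x$ when $X_t=e^{-t/2}X_0+\sqrt{1-e^{-t}}\,G$, $X_0\sim P_0$, $G\sim N(0,I_d)$ independent. $Y$ denotes a random variable with law $\mu_{x,t}$ and $\bar y_{x,t}=\mathbb E_{\mu_{x,t}}[Y]$. Doubling condition (UD). Let $M=\operatorname{supp}P_0$ (compact). For $\theta\in\mathbb S^{d-1}$ set $U_\theta(y)=\sup_{y'\in M}\langle\theta,y'\rangle-\langle\theta,y\rangle$ and $F_\theta(u)=P_0(\{y:U_\theta(y)\leq u\})$, $u>0$. (UD) with constant $D_{\mathrm{UD}}\geq1$ means $F_\theta(2u)\leq D_{\mathrm{UD}}F_\theta(u)$ for all $\theta\in\mathbb S^{d-1}$ and all $u>0$. *)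

theory Defs
  imports "HOL-Probability.Probability"
begin

text \<open>
  The dimension \<open>d\<close> is an explicit natural number rather than a type, because the
  constant \<open>C(q, D)\<close> of the theorem is uniform in \<open>d\<close> and so has to be quantified
  before it.  A point of \<open>d\<close>-dimensional Euclidean space is a function in
  \<open>{..<d} \<rightarrow>\<^sub>E UNIV\<close>, its norm is \<open>L2_set y {..<d}\<close>, and the Borel
  sigma-algebra is the finite product of the one-dimensional ones.
\<close>

abbreviation Rd :: "nat \<Rightarrow> (nat \<Rightarrow> real) set" where
  "Rd d \<equiv> {..<d} \<rightarrow>\<^sub>E UNIV"

abbreviation borel_Rd :: "nat \<Rightarrow> (nat \<Rightarrow> real) measure" where
  "borel_Rd d \<equiv> Pi\<^sub>M {..<d} (\<lambda>_. borel)"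

definition inner_Rd :: "nat \<Rightarrow> (nat \<Rightarrow> real) \<Rightarrow> (nat \<Rightarrow> real) \<Rightarrow> real" where
  "inner_Rd d x y = (\<Sum>i<d. x i * y i)"

abbreviation norm_Rd :: "nat \<Rightarrow> (nat \<Rightarrow> real) \<Rightarrow> real" where
  "norm_Rd d y \<equiv> L2_set y {..<d}"

definition supp :: "nat \<Rightarrow> (nat \<Rightarrow> real) measure \<Rightarrow> (nat \<Rightarrow> real) set" where
  "supp d P = {y \<in> Rd d. \<forall>r>0. 0 < measure P {z \<in> Rd d. norm_Rd d (\<lambda>i. z i - y i) < r}}"

definition U_UD :: "nat \<Rightarrow> (nat \<Rightarrow> real) measure \<Rightarrow> (nat \<Rightarrow> real) \<Rightarrow> (nat \<Rightarrow> real) \<Rightarrow> real" where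
  "U_UD d P \<theta> y = (SUP y'\<in>supp d P. inner_Rd d \<theta> y') - inner_Rd d \<theta> y"

definition F_UD :: "nat \<Rightarrow> (nat \<Rightarrow> real) measure \<Rightarrow> (nat \<Rightarrow> real) \<Rightarrow> real \<Rightarrow> real" where
  "F_UD d P \<theta> u = measure P {y \<in> Rd d. U_UD d P \<theta> y \<le> u}"

definition UD :: "nat \<Rightarrow> (nat \<Rightarrow> real) measure \<Rightarrow> real \<Rightarrow> bool" where
  "UD d P D \<longleftrightarrow> 1 \<le> D \<and>
     (\<forall>\<theta>\<in>Rd d. norm_Rd d \<theta> = 1 \<longrightarrow> (\<forall>u>0. F_UD d P \<theta> (2 * u) \<le> D * F_UD d P \<theta> u))"

definition kernel :: "nat \<Rightarrow> real \<Rightarrow> (nat \<Rightarrow> real) \<Rightarrow> (nat \<Rightarrow> real) \<Rightarrow> real" where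
  "kernel d t x y =
     exp (- ((norm_Rd d (\<lambda>i. x i - exp (- t / 2) * y i))\<^sup>2 / (2 * (1 - exp (- t)))))"

definition posterior ::
    "nat \<Rightarrow> (nat \<Rightarrow> real) measure \<Rightarrow> real \<Rightarrow> (nat \<Rightarrow> real) \<Rightarrow> (nat \<Rightarrow> real) measure" where
  "posterior d P t x =
     density P (\<lambda>y. ennreal (kernel d t x y / (\<integral>z. kernel d t x z \<partial>P)))"

definition posterior_mean ::
    "nat \<Rightarrow> (nat \<Rightarrow> real) measure \<Rightarrow> real \<Rightarrow> (nat \<Rightarrow> real) \<Rightarrow> nat \<Rightarrow> real" where
  "posterior_mean d P t x = (\<lambda>i\<in>{..<d}. \<integral>y. y i \<partial>(posterior d P t x))"

definition dev :: "nat \<Rightarrow> (nat \<Rightarrow> real) measure \<Rightarrow> real \<Rightarrow> (nat \<Rightarrow> real) \<Rightarrow> (nat \<Rightarrow> real) \<Rightarrow> real" where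
  "dev d P t x y = inner_Rd d x (\<lambda>i. y i - posterior_mean d P t x i)"

text \<open>Meaningful only if \<open>\<bar>f\<bar> powr q\<close> is integrable (the Bochner integral is 0 otherwise);
  the theorem asserts this integrability alongside the bounds.\<close>

definition Lq_norm :: "'a measure \<Rightarrow> real \<Rightarrow> ('a \<Rightarrow> real) \<Rightarrow> real" where
  "Lq_norm M q f = (\<integral>y. \<bar>f y\<bar> powr q \<partial>M) powr (1 / q)"

definition Delta0 :: "nat \<Rightarrow> (nat \<Rightarrow> real) measure \<Rightarrow> real" where
  "Delta0 d P = (SUP y\<in>supp d P. (norm_Rd d y)\<^sup>2) - (INF y\<in>supp d P. (norm_Rd d y)\<^sup>2)"

end

theory Submission
  imports Defs
begin

text \<open>Expanding the square, the posterior has a density proportional to \<open>exp (- 2 V - W)\<close> with respect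
  to \<open>P\<^sub>0\<close>, where \<open>V \<ge> 0\<close> is a multiple of the support function minus \<open>\<langle>x, y\<rangle>\<close> and
  \<open>W = \<bar>y\<bar>\<^sup>2 / (2 (exp t - 1))\<close> oscillates by at most \<open>b = \<Delta>\<^sub>0 / (2 (exp t - 1))\<close> on the support.
  Doubling of the distribution function of \<open>V\<close> gives \<open>E exp (- V) \<le> D * E exp (- 2 V)\<close> under \<open>P\<^sub>0\<close>,
  that is, \<open>E exp V \<le> D * exp b\<close> under the posterior. This exponential moment controls the mean of \<open>V\<close>
  by Jensen and its \<open>q\<close>-th moments through \<open>v\<^sup>q \<le> (q / exp 1)\<^sup>q * exp v \<le> \<Gamma>(q + 1) * exp v\<close>.\<close>


section \<open>Power inequalities and the Gamma function\<close>

text \<open>Split \<open>c powr q = c * c powr (q - 1)\<close> and bound the second factor by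
  \<open>(a + b) powr (q - 1)\<close>; adding the cases \<open>c = a\<close> and
  \<open>c = b\<close> gives the claim. It later merges two \<open>q\<close>-th powers into one
  without loss of constant.\<close>

lemma powr_superadditive:
  fixes a b q :: real
  assumes "0 \<le> a" "0 \<le> b" "1 \<le> q"
  shows "a powr q + b powr q \<le> (a + b) powr q"
proof -
  have *: "c powr q \<le> c * (a + b) powr (q - 1)" if "0 \<le> c" "c \<le> a + b" for c
  proof (cases "c = 0")
    case False
    then have "c powr q = c * c powr (q - 1)"
      using that powr_mult_base[of c "q - 1"] by simp
    then show ?thesis
      using that assms by (simp add: mult_left_mono powr_mono2)
  qed (use assms in simp)
  have "a powr q + b powr q \<le> (a + b) * (a + b) powr (q - 1)"
    using *[of a] *[of b] assms by (simp add: distrib_right)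
  also have "\<dots> = (a + b) powr q"
    using assms powr_mult_base[of "a + b" "q - 1"] by simp
  finally show ?thesis .
qed

lemma powr_add_le_two:
  fixes a b q :: real
  assumes "0 \<le> a" "0 \<le> b" "0 \<le> q"
  shows "(a + b) powr q \<le> 2 powr q * (a powr q + b powr q)"
proof -
  have "(a + b) powr q \<le> (2 * max a b) powr q"
    using assms by (intro powr_mono2) auto
  also have "\<dots> = 2 powr q * (max a b) powr q"
    using assms by (simp add: powr_mult)
  also have "\<dots> \<le> 2 powr q * (a powr q + b powr q)"
    by (intro mult_left_mono) (auto simp: max_def)
  finally show ?thesis .
qed

text \<open>Restrict Euler's integral to \<open>t \<ge> q\<close>, where
  \<open>t powr q \<ge> q powr q\<close>; the remaining integral of \<open>exp (- t)\<close> is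
  \<open>exp (- q)\<close>.\<close>

lemma powr_exp_neg_le_Gamma:
  fixes q :: real
  assumes "0 < q"
  shows "q powr q * exp (- q) \<le> Gamma (q + 1)"
proof -
  have "((\<lambda>t. exp (- 1 * t)) has_integral exp (- 1 * q) / 1) {q..}"
    by (rule has_integral_exp_minus_to_infinity) simp
  then have "((\<lambda>t. q powr q * exp (- t)) has_integral q powr q * exp (- q)) {q..}"
    by (intro has_integral_mult_right) simp
  then have "((\<lambda>t. if t \<in> {q..} then q powr q * exp (- t) else 0)
      has_integral q powr q * exp (- q)) {0..}"
    using assms by (subst has_integral_restrict) auto
  moreover have "((\<lambda>t. t powr q / exp t) has_integral Gamma (q + 1)) {0..}"
    using Gamma_integral_real[of "q + 1"] assms by simp
  ultimately show ?thesis
    by (rule has_integral_le)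
      (use assms in \<open>auto simp: exp_minus field_simps intro!: powr_mono2\<close>)
qed

text \<open>The function \<open>x powr q * exp (- x)\<close> peaks at \<open>x = q\<close>, which in
  logarithmic form is \<open>ln (x / q) \<le> x / q - 1\<close>; the peak value is the quantity just
  compared with Gamma.\<close>

lemma powr_le_Gamma_exp:
  fixes q x :: real
  assumes "1 \<le> q" "0 \<le> x"
  shows "x powr q \<le> Gamma (q + 1) * exp x"
proof (cases "x = 0")
  case True
  then show ?thesis using assms Gamma_real_pos[of "q + 1"] by simp
next
  case False
  then have x: "0 < x" using assms by simp
  have "ln (x / q) \<le> x / q - 1"
    using x assms by (intro ln_le_minus_one) simp
  then have "q * ln x - q * ln q \<le> x - q"
    using x assms by (simp add: ln_div field_simps)
  then have "exp (q * ln x) \<le> exp (q * ln q + (- q) + x)"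
    by simp
  then have "x powr q \<le> q powr q * exp (- q) * exp x"
    using x assms by (simp add: powr_def exp_add[symmetric])
  also have "\<dots> \<le> Gamma (q + 1) * exp x"
    using assms by (intro mult_right_mono powr_exp_neg_le_Gamma) auto
  finally show ?thesis .
qed

section \<open>Central moments from a single exponential moment\<close>

text \<open>Since \<open>0 \<le> E V \<le> A\<close>, the deviation \<open>\<bar>V - E V\<bar>\<close> is at most \<open>A + max 0 (V - A)\<close>, and the
  second summand is controlled by \<open>exp (V - A)\<close>, whose mean is at most 1.\<close>

lemma (in prob_space) central_moment_le_of_exp_moment:
  fixes V :: "'a \<Rightarrow> real"
  assumes V: "V \<in> borel_measurable M" "AE y in M. 0 \<le> V y"
    and int: "integrable M (\<lambda>y. exp (V y))"
    and le: "(\<integral>y. exp (V y) \<partial>M) \<le> exp A"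
    and A: "0 \<le> A" and q: "1 \<le> q"
  shows "integrable M V"
    and "integrable M (\<lambda>y. \<bar>V y - expectation V\<bar> powr q)"
    and "(\<integral>y. \<bar>V y - expectation V\<bar> powr q \<partial>M) \<le> (2 * (A + Gamma (q + 1) powr (1 / q))) powr q"
proof -
  define G where "G = Gamma (q + 1)"
  have G: "0 < G" unfolding G_def using q by (intro Gamma_real_pos) simp
  have Gq: "(G powr (1 / q)) powr q = G"
    using G q by (simp add: powr_powr)
  have expX: "exp (V y - A) = exp (V y) * exp (- A)" for y
    by (simp add: exp_diff exp_minus field_simps)
  have intX: "integrable M (\<lambda>y. exp (V y - A))"
    unfolding expX using int by simp
  have leX: "(\<integral>y. exp (V y - A) \<partial>M) \<le> 1"
  proof -
    have "(\<integral>y. exp (V y - A) \<partial>M) = (\<integral>y. exp (V y) \<partial>M) * exp (- A)"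
      unfolding expX by simp
    also have "\<dots> \<le> exp A * exp (- A)"
      using le by (intro mult_right_mono) auto
    finally show ?thesis by (simp add: exp_minus)
  qed
  show intV: "integrable M V"
    by (rule Bochner_Integration.integrable_bound[OF int V(1)])
      (use V(2) in \<open>auto simp: abs_of_nonneg elim!: eventually_mono intro: order_trans[OF _ exp_ge_add_one_self]\<close>)
  have m0: "0 \<le> expectation V"
    using V(2) by (rule integral_nonneg_AE)
  \<comment> \<open>Jensen for the logarithm in tangent form: integrate
    \<open>v \<le> A - 1 + exp (v - A)\<close>, the tangent to the exponential at
    \<open>v = A\<close>.\<close>
  have "expectation V \<le> (\<integral>y. A - 1 + exp (V y - A) \<partial>M)"
  proof (rule integral_mono[OF intV])
    show "integrable M (\<lambda>y. A - 1 + exp (V y - A))"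
      using intX by simp
    show "V y \<le> A - 1 + exp (V y - A)" for y
      using exp_ge_add_one_self[of "V y - A"] by linarith
  qed
  also have "\<dots> \<le> A"
    using intX leX by (simp add: prob_space)
  finally have mA: "expectation V \<le> A" .
  define H where "H y = 2 powr q * (A powr q + G * exp (V y - A))" for y
  have intH: "integrable M H"
    unfolding H_def using intX by simp
  have bound: "AE y in M. \<bar>V y - expectation V\<bar> powr q \<le> H y"
    using V(2)
  proof eventually_elim
    case (elim y)
    let ?x = "max 0 (V y - A)"
    have "\<bar>V y - expectation V\<bar> powr q \<le> (A + ?x) powr q"
      using elim m0 mA q by (intro powr_mono2) auto
    also have "\<dots> \<le> 2 powr q * (A powr q + ?x powr q)"
      using A q by (intro powr_add_le_two) auto
    also have "\<dots> \<le> H y"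
    proof -
      have "?x powr q \<le> G * exp (V y - A)"
      proof (cases "V y \<le> A")
        case True
        then show ?thesis using G by (simp add: max_def)
      next
        case False
        then show ?thesis
          using powr_le_Gamma_exp[of q ?x] q by (simp add: max_def G_def)
      qed
      then show ?thesis unfolding H_def by simp
    qed
    finally show ?case .
  qed
  show intq: "integrable M (\<lambda>y. \<bar>V y - expectation V\<bar> powr q)"
    by (rule Bochner_Integration.integrable_bound[OF intH])
      (use V(1) bound in \<open>auto elim!: eventually_mono\<close>)
  have "(\<integral>y. \<bar>V y - expectation V\<bar> powr q \<partial>M) \<le> (\<integral>y. H y \<partial>M)"
    by (rule integral_mono_AE[OF intq intH bound])
  also have "\<dots> = 2 powr q * (A powr q + G * (\<integral>y. exp (V y - A) \<partial>M))"
    unfolding H_def using intX by (simp add: prob_space)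
  \<comment> \<open>Rewriting \<open>G\<close> as a \<open>q\<close>-th power lets superadditivity
    collect everything into one \<open>q\<close>-th power, so that \<open>A\<close> and the root of
    Gamma simply add.\<close>
  also have "\<dots> \<le> 2 powr q * (A powr q + (G powr (1 / q)) powr q)"
    unfolding Gq using leX G by (intro mult_left_mono add_left_mono) (auto simp: mult_left_le)
  also have "\<dots> \<le> 2 powr q * (A + G powr (1 / q)) powr q"
    using A q by (intro mult_left_mono powr_superadditive) auto
  also have "\<dots> = (2 * (A + G powr (1 / q))) powr q"
    using A by (subst powr_mult) auto
  finally show "(\<integral>y. \<bar>V y - expectation V\<bar> powr q \<partial>M)
      \<le> (2 * (A + Gamma (q + 1) powr (1 / q))) powr q"
    unfolding G_def .
qed

section \<open>Laplace transforms under doubling, and exponential tilting\<close>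

lemma nn_integral_exp_neg_atLeast:
  fixes w :: real
  shows "(\<integral>\<^sup>+u. ennreal (exp (- u)) * indicator {w..} u \<partial>lborel) = ennreal (exp (- w))"
proof -
  have "((\<lambda>u. exp (- 1 * u)) has_integral exp (- 1 * w) / 1) {w..}"
    by (rule has_integral_exp_minus_to_infinity) simp
  then have "((\<lambda>u. exp (- u)) has_integral exp (- w)) {w..}" by simp
  then show ?thesis
    by (intro nn_integral_has_integral_lebesgue') auto
qed

text \<open>\<open>E exp (- U)\<close> is the integral of \<open>exp (- u) * P (U \<le> u)\<close> over \<open>u\<close>, so doubling of the distribution
  function transfers to the Laplace transform.\<close>

lemma (in prob_space) Laplace_doubling:
  fixes U :: "'a \<Rightarrow> real"
  assumes U[measurable]: "U \<in> borel_measurable M" and U0: "AE y in M. 0 \<le> U y"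
    and D: "1 \<le> D"
    and doubling: "\<And>u. 0 < u \<Longrightarrow> prob {y \<in> space M. U y \<le> 2 * u} \<le> D * prob {y \<in> space M. U y \<le> u}"
    and c: "0 < c"
  shows "expectation (\<lambda>y. exp (- (c * U y))) \<le> D * expectation (\<lambda>y. exp (- (2 * c * U y)))"
proof -
  \<comment> \<open>Layer-cake formula: write \<open>exp (- (a * U y))\<close> as the integral of
    \<open>exp (- u)\<close> over \<open>u \<ge> a * U y\<close> and exchange the integrals by
    Tonelli.\<close>
  have layer: "(\<integral>\<^sup>+y. ennreal (exp (- (a * U y))) \<partial>M)
      = (\<integral>\<^sup>+u. ennreal (exp (- u)) * emeasure M {y \<in> space M. U y \<le> u / a} \<partial>lborel)"
    if a: "0 < a" for a
  proof -
    interpret pair_sigma_finite M lborel ..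
    have "(\<integral>\<^sup>+y. ennreal (exp (- (a * U y))) \<partial>M)
        = (\<integral>\<^sup>+y. \<integral>\<^sup>+u. ennreal (exp (- u)) * indicator {y \<in> space M. U y \<le> u / a} y \<partial>lborel \<partial>M)"
      by (subst nn_integral_exp_neg_atLeast[symmetric])
        (use a in \<open>auto intro!: nn_integral_cong simp: indicator_def field_simps\<close>)
    also have "\<dots> = (\<integral>\<^sup>+u. \<integral>\<^sup>+y. ennreal (exp (- u)) * indicator {y \<in> space M. U y \<le> u / a} y \<partial>M \<partial>lborel)"
      by (rule Fubini'[symmetric]) (simp add: indicator_def)
    also have "\<dots> = (\<integral>\<^sup>+u. ennreal (exp (- u)) * emeasure M {y \<in> space M. U y \<le> u / a} \<partial>lborel)"
      by (intro nn_integral_cong) (simp add: nn_integral_cmult)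
    finally show ?thesis .
  qed
  \<comment> \<open>Doubling is assumed only for \<open>u > 0\<close>. At \<open>u = 0\<close> both
    events coincide and \<open>D \<ge> 1\<close> suffices; for \<open>u < 0\<close> the left event
    is null.\<close>
  have dbl: "emeasure M {y \<in> space M. U y \<le> 2 * u} \<le> ennreal D * emeasure M {y \<in> space M. U y \<le> u}" for u
  proof -
    consider "0 < u" | "u = 0" | "u < 0" by linarith
    then show ?thesis
    proof cases
      case 1
      then show ?thesis
        using doubling[of u] D by (simp add: emeasure_eq_measure ennreal_mult[symmetric])
    next
      case 2
      then show ?thesis
        using D mult_right_mono[of 1 D "prob {y \<in> space M. U y \<le> 0}"]
        by (simp add: emeasure_eq_measure ennreal_mult[symmetric])
    next
      case 3
      have "AE y in M. \<not> U y \<le> 2 * u"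
        using U0 by eventually_elim (use 3 in linarith)
      then have "emeasure M {y \<in> space M. U y \<le> 2 * u} = 0"
        by (subst (asm) AE_iff_measurable[OF _ refl]) auto
      then show ?thesis by simp
    qed
  qed
  have int: "integrable M (\<lambda>y. exp (- (a * U y)))" if "0 < a" for a
    by (rule integrable_const_bound[where B = 1]) (use U0 that in \<open>auto elim!: eventually_mono\<close>)
  \<comment> \<open>Since \<open>u / c\<close> is twice \<open>u / (2 * c)\<close>, doubling inside
    the layer-cake integral replaces the rate \<open>c\<close> by \<open>2 * c\<close>.\<close>
  have "(\<integral>\<^sup>+y. ennreal (exp (- (c * U y))) \<partial>M)
      \<le> (\<integral>\<^sup>+u. ennreal D * (ennreal (exp (- u)) * emeasure M {y \<in> space M. U y \<le> u / (2 * c)}) \<partial>lborel)"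
    unfolding layer[OF c]
  proof (intro nn_integral_mono)
    fix u :: real
    show "ennreal (exp (- u)) * emeasure M {y \<in> space M. U y \<le> u / c}
      \<le> ennreal D * (ennreal (exp (- u)) * emeasure M {y \<in> space M. U y \<le> u / (2 * c)})"
      using mult_left_mono[OF dbl[of "u / (2 * c)"], of "ennreal (exp (- u))"] by (simp add: ac_simps)
  qed
  also have "\<dots> = ennreal D * (\<integral>\<^sup>+y. ennreal (exp (- (2 * c * U y))) \<partial>M)"
    using c by (subst nn_integral_cmult) (auto simp: layer)
  finally have "ennreal (expectation (\<lambda>y. exp (- (c * U y))))
      \<le> ennreal (D * expectation (\<lambda>y. exp (- (2 * c * U y))))"
    using int[of c] int[of "2 * c"] c D
    by (simp add: nn_integral_eq_integral ennreal_mult)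
  then show ?thesis
    using D by (simp add: ennreal_le_iff integral_nonneg_AE)
qed



text \<open>Halving the tilt costs the Laplace transform ratio \<open>D\<close>, and the bounded perturbation \<open>W\<close> of
  oscillation \<open>b\<close> costs a further \<open>exp b\<close>.\<close>

lemma (in prob_space) tilted_exp_moment:
  fixes V W K :: "'a \<Rightarrow> real"
  assumes V[measurable]: "V \<in> borel_measurable M" and V0: "AE y in M. 0 \<le> V y"
    and W[measurable]: "W \<in> borel_measurable M" and W0: "AE y in M. w \<le> W y \<and> W y \<le> w + b"
    and half: "expectation (\<lambda>y. exp (- V y)) \<le> D * expectation (\<lambda>y. exp (- (2 * V y)))"
    and D: "1 \<le> D"
    and K: "\<And>y. K y = exp (c - 2 * V y - W y)"
  defines "N \<equiv> density M (\<lambda>y. ennreal (K y / (\<integral>z. K z \<partial>M)))"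
  shows "prob_space N"
    and "integrable N (\<lambda>y. exp (V y))"
    and "(\<integral>y. exp (V y) \<partial>N) \<le> D * exp b"
proof -
  have [measurable]: "K \<in> borel_measurable M" unfolding K by measurable
  define Z where "Z = (\<integral>z. K z \<partial>M)"
  have intV: "integrable M (\<lambda>y. exp (- (a * V y)))" if "0 \<le> a" for a
    by (rule integrable_const_bound[where B = 1]) (use V0 that in \<open>auto elim!: eventually_mono\<close>)
  have intK: "integrable M K"
    by (rule integrable_const_bound[where B = "exp (c - w)"])
      (use V0 W0 in \<open>eventually_elim, auto simp: K\<close>)
  \<comment> \<open>This is why the tilt is written as \<open>2 * V\<close>: the weight
    \<open>exp V\<close> removes exactly half of it and leaves the integrand on the left of
    \<open>half\<close>.\<close>
  have KV: "K y * exp (V y) = exp (c - V y - W y)" for y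
    by (simp add: K exp_add[symmetric])
  have intKV: "integrable M (\<lambda>y. K y * exp (V y))"
    unfolding KV
    by (rule integrable_const_bound[where B = "exp (c - w)"])
      (use V0 W0 in \<open>eventually_elim, auto\<close>)
  have pos2: "0 < expectation (\<lambda>y. exp (- (2 * V y)))"
    using intV[of 2] by (intro integral_less_AE_space[of "\<lambda>_. 0", simplified]) (auto simp: emeasure_space_1)
  \<comment> \<open>Lower bound for the normalizer from \<open>W \<le> w + b\<close>. The numerator
    below uses \<open>W \<ge> w\<close> instead, so \<open>c\<close> and \<open>w\<close> cancel in
    the quotient and only \<open>exp b\<close> remains.\<close>
  have "exp (c - w - b) * expectation (\<lambda>y. exp (- (2 * V y)))
      = (\<integral>y. exp (c - w - b) * exp (- (2 * V y)) \<partial>M)"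
    by simp
  also have "\<dots> \<le> Z"
    unfolding Z_def
  proof (rule integral_mono_AE)
    show "AE y in M. exp (c - w - b) * exp (- (2 * V y)) \<le> K y"
      using W0 by eventually_elim (auto simp: K exp_add[symmetric])
  qed (use intV[of 2] intK in auto)
  finally have Zge: "exp (c - w - b) * expectation (\<lambda>y. exp (- (2 * V y))) \<le> Z" .
  have Z: "0 < Z"
    using pos2 by (intro less_le_trans[OF _ Zge]) simp
  have N: "N = density M (\<lambda>y. ennreal (K y / Z))"
    unfolding N_def Z_def ..
  have K0: "0 \<le> K y" for y by (simp add: K)
  show "prob_space N"
  proof
    have "emeasure N (space N) = (\<integral>\<^sup>+y. ennreal (K y / Z) \<partial>M)"
      unfolding N by (simp add: emeasure_density cong: nn_integral_cong)
    also have "\<dots> = ennreal (\<integral>y. K y / Z \<partial>M)"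
      using intK K0 Z by (intro nn_integral_eq_integral) auto
    also have "(\<integral>y. K y / Z \<partial>M) = 1"
      using Z by (simp add: Z_def)
    finally show "emeasure N (space N) = 1" by simp
  qed
  show "integrable N (\<lambda>y. exp (V y))"
    unfolding N using K0 Z intKV by (subst integrable_density) (auto simp: mult.commute)
  have "(\<integral>y. exp (V y) \<partial>N) = (\<integral>y. K y * exp (V y) \<partial>M) / Z"
    unfolding N using K0 Z by (subst integral_density) auto
  also have "(\<integral>y. K y * exp (V y) \<partial>M) \<le> (\<integral>y. exp (c - w) * exp (- V y) \<partial>M)"
  proof (rule integral_mono_AE[OF intKV])
    show "AE y in M. K y * exp (V y) \<le> exp (c - w) * exp (- V y)"
      unfolding KV using W0 by eventually_elim (auto simp: exp_add[symmetric])
  qed (use intV[of 1] in auto)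
  also have "\<dots> \<le> exp (c - w) * (D * expectation (\<lambda>y. exp (- (2 * V y))))"
    using half by simp
  also have "\<dots> = D * exp b * (exp (c - w - b) * expectation (\<lambda>y. exp (- (2 * V y))))"
    by (simp add: exp_diff exp_add field_simps)
  also have "\<dots> \<le> D * exp b * Z"
    using Zge D by (intro mult_left_mono) auto
  finally show "(\<integral>y. exp (V y) \<partial>N) \<le> D * exp b"
    using Z by (simp add: divide_right_mono field_simps)
qed

section \<open>The support carries full measure\<close>

lemma norm_Rd_measurable:
  "(\<lambda>z. norm_Rd d (\<lambda>i. z i - c i)) \<in> borel_measurable (borel_Rd d)"
  unfolding L2_set_def by measurable

text \<open>Lindelof argument: each point outside the support has a null ball around it, which
  contains a null ball with rational centre and radius still containing the point. There are only
  countably many of these.\<close>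

lemma AE_supp:
  assumes "prob_space P" and P: "sets P = sets (borel_Rd d)"
  shows "AE y in P. y \<in> supp d P"
proof -
  interpret prob_space P by fact
  have sp: "space P = Rd d"
    using sets_eq_imp_space_eq[OF P] by (simp add: space_PiM)
  define B where "B y r = {z \<in> Rd d. norm_Rd d (\<lambda>i. z i - y i) < r}" for y r
  have Bm: "B y r \<in> sets P" for y r
  proof -
    have "{z \<in> space (borel_Rd d). norm_Rd d (\<lambda>i. z i - y i) < r} \<in> sets (borel_Rd d)"
      using norm_Rd_measurable by measurable
    then show ?thesis by (simp add: B_def P space_PiM)
  qed
  have tri: "norm_Rd d (\<lambda>i. x i - z i) \<le> norm_Rd d (\<lambda>i. x i - y i) + norm_Rd d (\<lambda>i. y i - z i)"
    for x y z :: "nat \<Rightarrow> real"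
    using L2_set_triangle_ineq[of "\<lambda>i. x i - y i" "\<lambda>i. y i - z i" "{..<d}"] by simp
  define I where "I = {cr \<in> (\<Pi>\<^sub>E i\<in>{..<d}. \<rat>) \<times> \<rat>. prob (B (fst cr) (snd cr)) = 0}"
  have "countable I"
  proof (rule countable_subset)
    show "I \<subseteq> (\<Pi>\<^sub>E i\<in>{..<d}. \<rat>) \<times> \<rat>"
      unfolding I_def by blast
    show "countable ((\<Pi>\<^sub>E i\<in>{..<d}. (\<rat> :: real set)) \<times> (\<rat> :: real set))"
      by (intro countable_SIGMA countable_PiE countable_rat) auto
  qed
  then have null: "(\<Union>cr\<in>I. B (fst cr) (snd cr)) \<in> null_sets P"
    using Bm by (intro null_sets_UN') (auto simp: I_def null_sets_def emeasure_eq_measure)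
  show ?thesis
  proof (rule AE_I'[OF null], safe)
    fix z assume z: "z \<in> space P" "z \<notin> supp d P"
    then obtain r where r: "0 < r" "prob (B z r) = 0"
      unfolding supp_def B_def sp by (auto simp: less_le measure_nonneg)
    \<comment> \<open>Using \<open>d + 1\<close> in place of \<open>d\<close> makes the sum of the
      \<open>d\<close> coordinate errors strictly smaller than \<open>r / 2\<close>, and also covers
      \<open>d = 0\<close>.\<close>
    have "\<exists>q\<in>\<rat>. \<bar>q - z i\<bar> < r / (2 * (d + 1))" for i
    proof -
      have "z i < z i + r / (2 * (d + 1))" using r by simp
      then obtain q where "q \<in> \<rat>" "z i < q" "q < z i + r / (2 * (d + 1))"
        using Rats_dense_in_real by blast
      then show ?thesis by (intro bexI[of _ q]) auto
    qed
    then obtain q where q: "\<And>i. q i \<in> \<rat>" "\<And>i. \<bar>q i - z i\<bar> < r / (2 * (d + 1))"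
      by metis
    \<comment> \<open>The restriction makes the centre an extensional function, as membership in the
      countable index set requires.\<close>
    define c where "c = restrict q {..<d}"
    have "norm_Rd d (\<lambda>i. c i - z i) \<le> (\<Sum>i<d. \<bar>c i - z i\<bar>)"
      by (rule L2_set_le_sum_abs)
    also have "\<dots> \<le> (\<Sum>i<d. r / (2 * (d + 1)))"
      using q(2) by (intro sum_mono) (auto simp: c_def less_imp_le)
    also have "\<dots> < r / 2"
      using r by (simp add: field_simps)
    finally have cz: "norm_Rd d (\<lambda>i. c i - z i) < r / 2" .
    \<comment> \<open>The lower bound on \<open>r'\<close> puts \<open>z\<close> in the ball around
      \<open>c\<close>; the upper bound keeps that ball inside the null ball around
      \<open>z\<close>, because the centre distance and \<open>r'\<close> are each below
      \<open>r / 2\<close>.\<close>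
    then obtain r' where r': "r' \<in> \<rat>" "norm_Rd d (\<lambda>i. c i - z i) < r'" "r' < r / 2"
      using Rats_dense_in_real by blast
    have sym: "norm_Rd d (\<lambda>i. z i - c i) = norm_Rd d (\<lambda>i. c i - z i)"
      by (simp add: L2_set_def power2_commute)
    have "B c r' \<subseteq> B z r"
    proof
      fix y assume "y \<in> B c r'"
      then show "y \<in> B z r"
        using tri[of y z c] cz r'(3) by (auto simp: B_def)
    qed
    then have "prob (B c r') = 0"
      using r finite_measure_mono[OF _ Bm, of "B c r'" z r] measure_nonneg[of P "B c r'"] by simp
    then have "(c, r') \<in> I"
      using q(1) r'(1) by (auto simp: I_def c_def)
    moreover have "z \<in> B c r'"
      using z r'(2) sym by (simp add: B_def sp)
    ultimately show "z \<in> (\<Union>cr\<in>I. B (fst cr) (snd cr))"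
      by force
  qed
qed


section \<open>Expansion of the Gaussian kernel\<close>

lemma abs_inner_Rd_le: "\<bar>inner_Rd d x y\<bar> \<le> norm_Rd d x * norm_Rd d y"
proof -
  have "\<bar>inner_Rd d x y\<bar> \<le> (\<Sum>i<d. \<bar>x i\<bar> * \<bar>y i\<bar>)"
    unfolding inner_Rd_def by (rule order_trans[OF sum_abs]) (simp add: abs_mult)
  also have "\<dots> \<le> norm_Rd d x * norm_Rd d y"
    by (rule L2_set_mult_ineq)
  finally show ?thesis .
qed

lemma inner_Rd_measurable: "inner_Rd d x \<in> borel_measurable (borel_Rd d)"
  unfolding inner_Rd_def[abs_def] by measurable

lemma norm_Rd_square: "(norm_Rd d y)\<^sup>2 = (\<Sum>i<d. (y i)\<^sup>2)"
  by (simp add: L2_set_def sum_nonneg)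

text \<open>Expanding the square separates a factor depending only on \<open>x\<close>, a linear
  tilt along \<open>x\<close>, and a quadratic term in \<open>y\<close>. With
  \<open>a = exp (t / 2)\<close> this becomes a rational identity in \<open>a\<close>.\<close>

lemma kernel_eq:
  assumes "0 < t"
  shows "kernel d t x y = exp (- ((norm_Rd d x)\<^sup>2 / (2 * (1 - exp (- t))))
    + exp (t / 2) / (exp t - 1) * inner_Rd d x y - (norm_Rd d y)\<^sup>2 / (2 * (exp t - 1)))"
proof -
  define a where "a = exp (t / 2)"
  have a: "1 < a" and a2: "exp t = a\<^sup>2"
    using assms by (auto simp: a_def exp_double[symmetric])
  have a2': "1 < a\<^sup>2" using a by (simp add: one_less_power)
  have "exp (- t / 2) = inverse a"
    unfolding a_def exp_minus[symmetric] by simp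
  then have "(x i - exp (- t / 2) * y i)\<^sup>2 = (x i)\<^sup>2 - 2 / a * (x i * y i) + (y i)\<^sup>2 / a\<^sup>2" for i
    using a by (simp only: power2_eq_square) (simp add: field_simps)
  then have "(norm_Rd d (\<lambda>i. x i - exp (- t / 2) * y i))\<^sup>2
      = (norm_Rd d x)\<^sup>2 - 2 / a * inner_Rd d x y + (norm_Rd d y)\<^sup>2 / a\<^sup>2"
    unfolding norm_Rd_square inner_Rd_def
    by (simp only: sum.distrib sum_subtractf sum_distrib_left sum_divide_distrib)
  moreover have "1 - exp (- t) = (a\<^sup>2 - 1) / a\<^sup>2"
    unfolding exp_minus a2 using a by (simp add: field_simps)
  moreover have "- ((p - 2 / a * q + r / a\<^sup>2) / (2 * ((a\<^sup>2 - 1) / a\<^sup>2)))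
      = - (p / (2 * ((a\<^sup>2 - 1) / a\<^sup>2))) + a / (a\<^sup>2 - 1) * q - r / (2 * (a\<^sup>2 - 1))" for p q r
  proof -
    define e where "e = a\<^sup>2 - 1"
    then have "e \<noteq> 0" using a2' by simp
    then show ?thesis
      unfolding e_def[symmetric] using a by (simp add: field_simps power2_eq_square)
  qed
  ultimately show ?thesis
    unfolding kernel_def by (simp only: a2 a_def[symmetric])
qed

section \<open>Consequences of (UD) and of the bounded support\<close>

text \<open>For \<open>x\<close> of positive norm, (UD) is applied in the direction
  \<open>x / \<rho>\<close>, and \<open>m\<close> is \<open>\<rho>\<close> times the support
  function \<open>S\<close> there. The norm \<open>\<rho>\<close> is then absorbed into the rate of
  the Laplace transform.\<close>

lemma half_tilt:
  assumes P: "prob_space P" and sets: "sets P = sets (borel_Rd d)"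
    and supp: "supp d P \<subseteq> {y \<in> Rd d. norm_Rd d y \<le> R}" and UD: "UD d P D"
  obtains m where "AE y in P. inner_Rd d x y \<le> m"
    and "\<And>c. 0 < c \<Longrightarrow> (\<integral>y. exp (- (c * (m - inner_Rd d x y))) \<partial>P)
        \<le> D * (\<integral>y. exp (- (2 * (c * (m - inner_Rd d x y)))) \<partial>P)"
proof -
  interpret prob_space P by fact
  have sp: "space P = Rd d"
    using sets_eq_imp_space_eq[OF sets] by (simp add: space_PiM)
  have [measurable]: "inner_Rd d z \<in> borel_measurable P" for z
    using inner_Rd_measurable sets by (simp cong: measurable_cong_sets)
  have D: "1 \<le> D" using UD by (simp add: UD_def)
  define \<rho> where "\<rho> = norm_Rd d x"
  show thesis
  proof (cases "\<rho> = 0")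
    \<comment> \<open>There is no direction to normalize here, but the inner product vanishes
      identically, so \<open>m = 0\<close> works and the inequality reduces to
      \<open>1 \<le> D\<close>.\<close>
    case True
    then have "inner_Rd d x y = 0" for y
      by (simp add: \<rho>_def L2_set_eq_0_iff inner_Rd_def)
    then show thesis
      using D by (intro that[of 0]) (auto simp: prob_space)
  next
    case False
    then have \<rho>: "0 < \<rho>" by (simp add: \<rho>_def less_le)
    define \<theta> where "\<theta> = (\<lambda>i\<in>{..<d}. x i / \<rho>)"
    have \<theta>x: "inner_Rd d x y = \<rho> * inner_Rd d \<theta> y" for y
      using \<rho> by (simp add: inner_Rd_def \<theta>_def sum_distrib_left)
    have "norm_Rd d \<theta> = norm_Rd d (\<lambda>i. x i * (1 / \<rho>))"
      by (rule L2_set_cong) (auto simp: \<theta>_def)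
    also have "\<dots> = 1"
      using \<rho> L2_set_left_distrib[of "1 / \<rho>" x "{..<d}"] by (simp add: \<rho>_def)
    finally have \<theta>1: "norm_Rd d \<theta> = 1" .
    have \<theta>: "\<theta> \<in> Rd d" by (simp add: \<theta>_def)
    define S where "S = (SUP y'\<in>supp d P. inner_Rd d \<theta> y')"
    have bdd: "bdd_above (inner_Rd d \<theta> ` supp d P)"
    proof (rule bdd_aboveI2)
      fix y assume "y \<in> supp d P"
      then show "inner_Rd d \<theta> y \<le> R"
        using supp abs_inner_Rd_le[of d \<theta> y] by (auto simp: \<theta>1)
    qed
    have U: "U_UD d P \<theta> = (\<lambda>y. S - inner_Rd d \<theta> y)"
      by (simp add: fun_eq_iff U_UD_def S_def)
    have le: "AE y in P. inner_Rd d \<theta> y \<le> S"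
      using AE_supp[OF P sets]
      by eventually_elim (auto simp: S_def intro: cSUP_upper bdd)
    have dbl: "prob {y \<in> space P. S - inner_Rd d \<theta> y \<le> 2 * u}
        \<le> D * prob {y \<in> space P. S - inner_Rd d \<theta> y \<le> u}" if "0 < u" for u
    proof -
      have "F_UD d P \<theta> (2 * u) \<le> D * F_UD d P \<theta> u"
        using UD \<theta> \<theta>1 that unfolding UD_def by blast
      then show ?thesis by (simp only: F_UD_def U sp)
    qed
    show thesis
    proof (rule that[of "\<rho> * S"])
      show "AE y in P. inner_Rd d x y \<le> \<rho> * S"
        using le by eventually_elim (use \<rho> in \<open>simp add: \<theta>x\<close>)
      fix c :: real assume "0 < c"
      moreover have "c * (\<rho> * S - inner_Rd d x y) = c * \<rho> * (S - inner_Rd d \<theta> y)" for y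
        by (simp add: \<theta>x algebra_simps)
      ultimately show "(\<integral>y. exp (- (c * (\<rho> * S - inner_Rd d x y))) \<partial>P)
        \<le> D * (\<integral>y. exp (- (2 * (c * (\<rho> * S - inner_Rd d x y)))) \<partial>P)"
        using Laplace_doubling[OF _ _ D dbl, of "c * \<rho>"] le \<rho>
        by (simp add: mult.assoc)
    qed
  qed
qed

lemma Delta0_bounds:
  assumes P: "prob_space P" and sets: "sets P = sets (borel_Rd d)"
    and supp: "supp d P \<subseteq> {y \<in> Rd d. norm_Rd d y \<le> R}"
  shows "0 \<le> R" and "0 \<le> Delta0 d P" and "Delta0 d P \<le> R\<^sup>2"
    and "AE y in P. (INF y\<in>supp d P. (norm_Rd d y)\<^sup>2) \<le> (norm_Rd d y)\<^sup>2
      \<and> (norm_Rd d y)\<^sup>2 \<le> (INF y\<in>supp d P. (norm_Rd d y)\<^sup>2) + Delta0 d P"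
proof -
  interpret prob_space P by fact
  have ae: "AE y in P. y \<in> supp d P" by (rule AE_supp[OF P sets])
  \<comment> \<open>An empty set cannot have full measure under a probability. Nonemptiness yields
    \<open>0 \<le> R\<close> and gives the supremum and infimum their intended meaning.\<close>
  have ne: "supp d P \<noteq> {}"
    using ae by (auto simp: AE_False)
  then obtain y0 where y0: "y0 \<in> supp d P" by blast
  then have "norm_Rd d y0 \<le> R" using supp by blast
  then show R: "0 \<le> R" using L2_set_nonneg[of y0 "{..<d}"] by linarith
  have le: "(norm_Rd d y)\<^sup>2 \<le> R\<^sup>2" if "y \<in> supp d P" for y
    using that supp by (intro power_mono) auto
  have up: "bdd_above ((\<lambda>y. (norm_Rd d y)\<^sup>2) ` supp d P)"
    using le by (intro bdd_aboveI2[where M = "R\<^sup>2"])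
  have lo: "bdd_below ((\<lambda>y. (norm_Rd d y)\<^sup>2) ` supp d P)"
    by (intro bdd_belowI2[where m = 0]) simp
  have *: "(INF y\<in>supp d P. (norm_Rd d y)\<^sup>2) \<le> (norm_Rd d y)\<^sup>2
      \<and> (norm_Rd d y)\<^sup>2 \<le> (INF y\<in>supp d P. (norm_Rd d y)\<^sup>2) + Delta0 d P" if "y \<in> supp d P" for y
    using cSUP_upper[OF that up] cINF_lower[OF lo that] by (simp add: Delta0_def)
  show "AE y in P. (INF y\<in>supp d P. (norm_Rd d y)\<^sup>2) \<le> (norm_Rd d y)\<^sup>2
      \<and> (norm_Rd d y)\<^sup>2 \<le> (INF y\<in>supp d P. (norm_Rd d y)\<^sup>2) + Delta0 d P"
    using ae by eventually_elim (rule *)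
  show "0 \<le> Delta0 d P" using *[OF y0] by linarith
  have "(SUP y\<in>supp d P. (norm_Rd d y)\<^sup>2) \<le> R\<^sup>2"
    using le by (intro cSUP_least[OF ne])
  moreover have "0 \<le> (INF y\<in>supp d P. (norm_Rd d y)\<^sup>2)"
    by (intro cINF_greatest[OF ne]) simp
  ultimately show "Delta0 d P \<le> R\<^sup>2" by (simp add: Delta0_def)
qed

section \<open>Moments under the posterior\<close>

text \<open>Up to the factor \<open>- 2 / s\<close>, the deviation is \<open>V\<close> minus its
  posterior mean, so the central moment bound applies to \<open>V\<close> with
  \<open>exp A = D * exp b\<close>.\<close>

lemma posterior_moment_bound:
  assumes P: "prob_space P" and sets: "sets P = sets (borel_Rd d)"
    and supp: "supp d P \<subseteq> {y \<in> Rd d. norm_Rd d y \<le> R}" and UD: "UD d P D"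
    and q: "1 \<le> q" and t: "0 < t"
  shows "integrable (posterior d P t x) (\<lambda>y. \<bar>dev d P t x y\<bar> powr q)"
    and "(\<integral>y. \<bar>dev d P t x y\<bar> powr q \<partial>(posterior d P t x))
      \<le> (4 * exp (- t / 2) * ((exp t - 1) * (ln D + Gamma (q + 1) powr (1 / q)) + Delta0 d P / 2)) powr q"
proof -
  interpret prob_space P by fact
  have [measurable]: "inner_Rd d x \<in> borel_measurable P"
    using inner_Rd_measurable sets by (simp cong: measurable_cong_sets)
  have [measurable]: "(\<lambda>y. norm_Rd d y) \<in> borel_measurable P"
    using norm_Rd_measurable[where d = d and c = "\<lambda>_. 0"] sets by (simp cong: measurable_cong_sets)
  have D: "1 \<le> D" using UD by (simp add: UD_def)
  define E where "E = exp t - 1"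
  \<comment> \<open>\<open>s\<close> is the coefficient of the linear tilt in the kernel, and
    \<open>b\<close> bounds the oscillation of its quadratic term over the support.\<close>
  define s where "s = exp (t / 2) / E"
  define b where "b = Delta0 d P / (2 * E)"
  define A where "A = ln D + b"
  define N where "N = posterior d P t x"
  define w where "w = (INF y\<in>supp d P. (norm_Rd d y)\<^sup>2)"
  note bounds = Delta0_bounds[OF P sets supp, folded w_def]
  have E: "0 < E" using t by (simp add: E_def)
  have s: "0 < s" using E by (simp add: s_def)
  have b: "0 \<le> b" using E bounds(2) by (simp add: b_def)
  have A: "0 \<le> A" using b D by (simp add: A_def)
  have expA: "exp A = D * exp b" using D by (simp add: A_def exp_add)
  obtain m where m: "AE y in P. inner_Rd d x y \<le> m"
    and half: "\<And>c. 0 < c \<Longrightarrow> (\<integral>y. exp (- (c * (m - inner_Rd d x y))) \<partial>P)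
        \<le> D * (\<integral>y. exp (- (2 * (c * (m - inner_Rd d x y)))) \<partial>P)"
    using half_tilt[OF P sets supp UD] by metis
  define V where "V y = s / 2 * (m - inner_Rd d x y)" for y
  have Vm[measurable]: "V \<in> borel_measurable P" unfolding V_def by measurable
  have V0: "AE y in P. 0 \<le> V y"
    using m by eventually_elim (use s in \<open>simp add: V_def\<close>)
  have W0: "AE y in P. w / (2 * E) \<le> (norm_Rd d y)\<^sup>2 / (2 * E)
      \<and> (norm_Rd d y)\<^sup>2 / (2 * E) \<le> w / (2 * E) + b"
    using bounds(4)
    by eventually_elim (use E in \<open>auto simp: b_def add_divide_distrib[symmetric] intro!: divide_right_mono\<close>)
  \<comment> \<open>The constant \<open>s * m\<close> is inserted to turn the linear tilt into
    \<open>- 2 * V\<close> with \<open>V \<ge> 0\<close>; with the term in \<open>x\<close> alone it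
    cancels on normalization.\<close>
  have K: "kernel d t x y = exp ((s * m - (norm_Rd d x)\<^sup>2 / (2 * (1 - exp (- t))))
      - 2 * V y - (norm_Rd d y)\<^sup>2 / (2 * E))" for y
    unfolding kernel_eq[OF t] E_def[symmetric] s_def[symmetric] V_def by (simp add: algebra_simps)
  have half': "expectation (\<lambda>y. exp (- V y)) \<le> D * expectation (\<lambda>y. exp (- (2 * V y)))"
    unfolding V_def using s by (intro half) simp
  have Wm: "(\<lambda>y. (norm_Rd d y)\<^sup>2 / (2 * E)) \<in> borel_measurable P" by measurable
  note tilt = tilted_exp_moment[OF Vm V0 Wm W0 half' D K, folded posterior_def, folded N_def]
  interpret N: prob_space N by (rule tilt(1))
  have setsN: "sets N = sets P" by (simp add: N_def posterior_def)
  have VN: "V \<in> borel_measurable N"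
    using Vm setsN by (simp cong: measurable_cong_sets)
  have Km: "(\<lambda>y. ennreal (kernel d t x y / (\<integral>z. kernel d t x z \<partial>P))) \<in> borel_measurable P"
    unfolding K by measurable
  have AEN: "AE y in N. Q y" if "AE y in P. Q y" for Q
    using that unfolding N_def posterior_def AE_density[OF Km] by eventually_elim simp
  note mom = N.central_moment_le_of_exp_moment[OF VN AEN[OF V0] tilt(2) tilt(3)[folded expA] A q]
  \<comment> \<open>The posterior mean is defined coordinate by coordinate, so integrable
    coordinates are needed to exchange expectation and inner product.\<close>
  have coord: "integrable N (\<lambda>y. y i)" if "i < d" for i
  proof (rule N.integrable_const_bound[where B = R])
    have "AE y in P. \<bar>y i\<bar> \<le> R"
      using AE_supp[OF P sets]
    proof eventually_elim
      case (elim y)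
      have "\<bar>y i\<bar> \<le> norm_Rd d (\<lambda>i. \<bar>y i\<bar>)"
        using that by (intro member_le_L2_set) auto
      also have "\<dots> = norm_Rd d y" by (simp add: L2_set_def)
      also have "\<dots> \<le> R" using elim supp by auto
      finally show ?case .
    qed
    then show "AE y in N. norm (y i) \<le> R"
      by (intro AEN) simp
    have "(\<lambda>y. y i) \<in> borel_measurable (borel_Rd d)" using that by (intro measurable_component_singleton) simp
    then show "(\<lambda>y. y i) \<in> borel_measurable N"
      using setsN sets by (simp cong: measurable_cong_sets)
  qed
  have mean: "N.expectation V = s / 2 * (m - inner_Rd d x (posterior_mean d P t x))"
  proof -
    have "N.expectation (inner_Rd d x) = (\<Sum>i<d. x i * N.expectation (\<lambda>y. y i))"
      unfolding inner_Rd_def using coord by (subst Bochner_Integration.integral_sum) auto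
    also have "\<dots> = inner_Rd d x (posterior_mean d P t x)"
      unfolding inner_Rd_def posterior_mean_def N_def by simp
    finally have "N.expectation (inner_Rd d x) = inner_Rd d x (posterior_mean d P t x)" .
    moreover have "integrable N (inner_Rd d x)"
      unfolding inner_Rd_def using coord by auto
    ultimately show ?thesis
      unfolding V_def by (simp add: N.prob_space)
  qed
  have dev: "\<bar>dev d P t x y\<bar> = 2 / s * \<bar>V y - N.expectation V\<bar>" for y
  proof -
    have "dev d P t x y = inner_Rd d x y - inner_Rd d x (posterior_mean d P t x)"
      by (simp add: dev_def inner_Rd_def right_diff_distrib sum_subtractf)
    also have "\<dots> = - (2 / s) * (V y - N.expectation V)"
      unfolding mean V_def using s by (simp add: field_simps)
    finally show ?thesis using s by (simp only: abs_mult) simp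
  qed
  have devq: "\<bar>dev d P t x y\<bar> powr q = (2 / s) powr q * \<bar>V y - N.expectation V\<bar> powr q" for y
    unfolding dev by (rule powr_mult)
  show "integrable (posterior d P t x) (\<lambda>y. \<bar>dev d P t x y\<bar> powr q)"
    unfolding N_def[symmetric] devq using mom(2) by simp
  let ?G = "Gamma (q + 1) powr (1 / q)"
  have "(\<integral>y. \<bar>dev d P t x y\<bar> powr q \<partial>N) \<le> (2 / s) powr q * (2 * (A + ?G)) powr q"
    unfolding devq using mom(3) by (simp add: mult_left_mono)
  also have "\<dots> = (2 / s * (2 * (A + ?G))) powr q"
    using s A by (subst powr_mult) auto
  \<comment> \<open>Here \<open>1 / s = E * exp (- t / 2)\<close> and
    \<open>E * b = Delta0 d P / 2\<close>. The 4 combines the 2 from halving the tilt with the 2 of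
    the central moment bound.\<close>
  also have "2 / s * (2 * (A + ?G)) = 4 * exp (- t / 2) * (E * (ln D + ?G) + Delta0 d P / 2)"
    using E by (simp add: s_def A_def b_def exp_minus field_simps)
  finally show "(\<integral>y. \<bar>dev d P t x y\<bar> powr q \<partial>(posterior d P t x))
      \<le> (4 * exp (- t / 2) * ((exp t - 1) * (ln D + ?G) + Delta0 d P / 2)) powr q"
    unfolding N_def E_def .
qed

section \<open>The norm bound and the uniform moment constant\<close>

theorem theorem3p2:
  shows "\<exists>C :: real \<Rightarrow> real \<Rightarrow> real.
    \<forall>(d::nat) (P0 :: (nat \<Rightarrow> real) measure) (R::real) (D::real).
      1 \<le> d \<longrightarrow> prob_space P0 \<longrightarrow> sets P0 = sets (borel_Rd d) \<longrightarrow>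
      supp d P0 \<subseteq> {y \<in> Rd d. norm_Rd d y \<le> R} \<longrightarrow> UD d P0 D \<longrightarrow>
        Delta0 d P0 \<le> R\<^sup>2 \<and>
        (\<forall>q\<ge>1. \<forall>t>0. \<forall>x\<in>Rd d.
           integrable (posterior d P0 t x) (\<lambda>y. \<bar>dev d P0 t x y\<bar> powr q) \<and>
           Lq_norm (posterior d P0 t x) q (dev d P0 t x)
             \<le> 4 * exp (- t / 2) *
                ((exp t - 1) * (ln D + Gamma (q + 1) powr (1 / q)) + Delta0 d P0 / 2) \<and>
           (\<integral>y. \<bar>dev d P0 t x y\<bar> powr q \<partial>(posterior d P0 t x))
             \<le> C q D * (exp (q * t / 2) + exp (- q * t / 2) * R powr (2 * q)))"
proof (rule exI[of _ "\<lambda>q D. 8 powr q * ((ln D + Gamma (q + 1) powr (1 / q)) powr q + 1)"],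
    intro allI impI conjI ballI)
  fix d :: nat and P :: "(nat \<Rightarrow> real) measure" and R D :: real
  assume P: "prob_space P" and sets: "sets P = sets (borel_Rd d)"
    and supp: "supp d P \<subseteq> {y \<in> Rd d. norm_Rd d y \<le> R}" and UD: "UD d P D"
  note bounds = Delta0_bounds[OF P sets supp]
  have D: "1 \<le> D" using UD by (simp add: UD_def)
  show "Delta0 d P \<le> R\<^sup>2" by (rule bounds(3))
  fix q t :: real and x
  assume q: "1 \<le> q" and t: "0 < t"
  note mom = posterior_moment_bound[OF P sets supp UD q t, of x]
  show "integrable (posterior d P t x) (\<lambda>y. \<bar>dev d P t x y\<bar> powr q)" by (rule mom(1))
  define L where "L = ln D + Gamma (q + 1) powr (1 / q)"
  have L: "0 \<le> L" using D by (simp add: L_def)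
  define B where "B = 4 * exp (- t / 2) * ((exp t - 1) * L + Delta0 d P / 2)"
  have B: "0 \<le> B"
    using L bounds(2) t by (simp add: B_def)
  have le: "(\<integral>y. \<bar>dev d P t x y\<bar> powr q \<partial>(posterior d P t x)) \<le> B powr q"
    unfolding B_def L_def by (rule mom(2))
  have "Lq_norm (posterior d P t x) q (dev d P t x) \<le> (B powr q) powr (1 / q)"
    unfolding Lq_norm_def using le q by (intro powr_mono2 integral_nonneg_AE) auto
  also have "\<dots> = B" using B q by (simp add: powr_powr)
  finally show "Lq_norm (posterior d P t x) q (dev d P t x) \<le> 4 * exp (- t / 2) *
      ((exp t - 1) * (ln D + Gamma (q + 1) powr (1 / q)) + Delta0 d P / 2)"
    unfolding B_def L_def .
  have e: "exp (- t / 2) * exp t = exp (t / 2)" by (simp add: exp_add[symmetric])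
  \<comment> \<open>Crude bounds \<open>exp t - 1 \<le> exp t\<close> and
    \<open>Delta0 d P / 2 \<le> R\<^sup>2\<close>, the latter from
    \<open>0 \<le> Delta0 d P \<le> R\<^sup>2\<close>, remove everything but \<open>t\<close>,
    \<open>R\<close> and \<open>L\<close>.\<close>
  have "B \<le> 4 * exp (- t / 2) * (exp t * L + R\<^sup>2)"
    unfolding B_def using L bounds(2,3)
    by (intro mult_left_mono add_mono mult_right_mono) auto
  also have "\<dots> = 4 * (exp (t / 2) * L + exp (- t / 2) * R\<^sup>2)"
    by (simp add: e[symmetric] algebra_simps)
  finally have "B powr q \<le> (4 * (exp (t / 2) * L + exp (- t / 2) * R\<^sup>2)) powr q"
    using B q by (intro powr_mono2) auto
  also have "\<dots> = 4 powr q * (exp (t / 2) * L + exp (- t / 2) * R\<^sup>2) powr q"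
    using L by (subst powr_mult) auto
  also have "\<dots> \<le> 4 powr q * (2 powr q * ((exp (t / 2) * L) powr q + (exp (- t / 2) * R\<^sup>2) powr q))"
    using L q by (intro mult_left_mono powr_add_le_two) auto
  \<comment> \<open>The 8 is the 4 of the norm bound times the 2 lost in splitting the sum.\<close>
  also have "\<dots> = 8 powr q * ((exp (t / 2) * L) powr q + (exp (- t / 2) * R\<^sup>2) powr q)"
    by (simp add: powr_mult[symmetric] mult.assoc[symmetric])
  also have "(exp (t / 2) * L) powr q = exp (q * t / 2) * L powr q"
    using L by (simp add: powr_mult exp_powr_real mult.commute)
  also have "(exp (- t / 2) * R\<^sup>2) powr q = exp (- q * t / 2) * R powr (2 * q)"
  proof -
    have "(R\<^sup>2) powr q = R powr (2 * q)"
      using bounds(1) by (cases "R = 0") (simp_all add: powr_powr[symmetric])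
    then show ?thesis by (simp add: powr_mult exp_powr_real mult.commute)
  qed
  \<comment> \<open>\<open>L powr q + 1\<close> dominates both coefficients, \<open>L powr q\<close>
    and 1, which gives a constant depending only on \<open>q\<close> and \<open>D\<close>.\<close>
  also have "8 powr q * (exp (q * t / 2) * L powr q + exp (- q * t / 2) * R powr (2 * q))
      \<le> 8 powr q * ((L powr q + 1) * (exp (q * t / 2) + exp (- q * t / 2) * R powr (2 * q)))"
    by (intro mult_left_mono) (simp_all add: algebra_simps)
  finally have "B powr q \<le> 8 powr q * (L powr q + 1)
      * (exp (q * t / 2) + exp (- q * t / 2) * R powr (2 * q))"
    by (simp add: mult.assoc)
  with le show "(\<integral>y. \<bar>dev d P t x y\<bar> powr q \<partial>(posterior d P t x))
      \<le> 8 powr q * ((ln D + Gamma (q + 1) powr (1 / q)) powr q + 1)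
        * (exp (q * t / 2) + exp (- q * t / 2) * R powr (2 * q))"
    unfolding L_def by linarith
qed

end
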